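(* Let $\mathbb{B}_0=(\sigma_x,\sigma_y,\sigma_z)$ be the basis of $\mathfrak{su}(2)$ with $[\sigma_x,\sigma_y]=2\sigma_z$, $[\sigma_y,\sigma_z]=2\sigma_x$, $[\sigma_z,\sigma_x]=2\sigma_y$. Let $\mu_1\ge\mu_2>0$, $\mu_3>0$ and consider the left invariant metric on $\mathrm{SU}(2)$ with matrix $\mathrm{diag}(\mu_1,\mu_2,-\mu_3)$ in $\mathbb{B}_0$. Its Ricci curvature and scalar curvature are $$M(\mathrm{ric},\mathbb{B}_0)=\mathrm{diag}\left[-\tfrac{2(\mu_1-\mu_2-\mu_3)(\mu_1+\mu_2+\mu_3)}{\mu_2\mu_3},\ \tfrac{2(\mu_1+\mu_2+\mu_3)(\mu_1-\mu_2+\mu_3)}{\mu_1\mu_3},\ -\tfrac{2(\mu_1-\mu_2-\mu_3)(\mu_1-\mu_2+\mu_3)}{\mu_1\mu_2}\right],$$ $$\mathfrak{s}=\frac{2\big((\sqrt{\mu_1}+\sqrt{\mu_2})^2+\mu_3\big)\big((\sqrt{\mu_1}-\sqrt{\mu_2})^2+\mu_3\big)}{\mu_1\mu_2\mu_3}>0.$$ Moreover, the signature of $\mathrm{ric}$ is $(+,+,+)$ if $\mu_1<\mu_2+\mu_3$, $(+,-,-)$ if $\mu_1>\mu_2+\mu_3$, and $(+,0,0)$ if $\mu_1=\mu_2+\mu_3$.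
   Context: A left invariant metric on a Lie group with Lie algebra $\mathfrak{g}$ is identified with a nondegenerate symmetric bilinear form $\langle\,,\rangle$ on $\mathfrak{g}$. The Levi-Civita product $\mathrm{L}:\mathfrak{g}\times\mathfrak{g}\to\mathfrak{g}$ is given by $2\langle\mathrm{L}_uv,w\rangle=\langle[u,v],w\rangle+\langle[w,u],v\rangle+\langle[w,v],u\rangle$, the curvature by $\mathrm{K}(u,v)=\mathrm{L}_{[u,v]}-[\mathrm{L}_u,\mathrm{L}_v]$, the Ricci tensor by $\mathrm{ric}(u,v)=\mathrm{tr}(w\mapsto\mathrm{K}(u,w)v)$, the Ricci operator by $\langle\mathrm{Ric}(u),v\rangle=\mathrm{ric}(u,v)$, and the scalar curvature by $\mathfrak{s}=\mathrm{tr}(\mathrm{Ric})$. $M(\mathrm{ric},\mathbb{B}_0)$ is the Gram matrix of $\mathrm{ric}$ in $\mathbb{B}_0$. The signature of $\mathrm{ric}$ is its signature as a symmetric bilinear form (the signs of the diagonal entries of any diagonalization by congruence, in any order). *)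

theory Defs
  imports "HOL-Analysis.Analysis" "HOL-Library.Multiset"
begin

definition su2 :: "(complex^2^2) set" where
  "su2 = {A. map_matrix cnj (transpose A) = - A \<and> trace A = 0}"

definition commutator :: "'a::ring_1^'n^'n \<Rightarrow> 'a^'n^'n \<Rightarrow> 'a^'n^'n" where
  "commutator A B = A ** B - B ** A"

text \<open>
  Below, a Lie algebra is given by its carrier \<open>V\<close>, a finite-dimensional real subspace of an
  ambient vector space, and its bracket \<open>br\<close>. Bilinear forms are functions on the ambient space
  of which only the values on \<open>V\<close> matter.
\<close>

definition ordered_basis :: "'a::real_vector set \<Rightarrow> 'a^'n \<Rightarrow> bool" where
  "ordered_basis V b \<longleftrightarrow>
     inj (($) b) \<and> independent (range (($) b)) \<and> span (range (($) b)) = V"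

definition gram_matrix :: "('a \<Rightarrow> 'a \<Rightarrow> real) \<Rightarrow> 'a^'n \<Rightarrow> real^'n^'n" where
  "gram_matrix \<beta> b = (\<chi> i j. \<beta> (b $ i) (b $ j))"

definition diag :: "real^'n \<Rightarrow> real^'n^'n" where
  "diag d = (\<chi> i j. if i = j then d $ i else 0)"

text \<open>A left invariant metric on a Lie group is identified with such a form on its Lie algebra.\<close>

definition metric_on :: "'a::real_vector set \<Rightarrow> ('a \<Rightarrow> 'a \<Rightarrow> real) \<Rightarrow> bool" where
  "metric_on V g \<longleftrightarrow>
     (\<forall>u\<in>V. \<forall>v\<in>V. g u v = g v u) \<and>
     (\<forall>u\<in>V. \<forall>v\<in>V. \<forall>w\<in>V. g (u + v) w = g u w + g v w) \<and>
     (\<forall>c. \<forall>u\<in>V. \<forall>v\<in>V. g (c *\<^sub>R u) v = c * g u v) \<and>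
     (\<forall>u\<in>V. (\<forall>v\<in>V. g u v = 0) \<longrightarrow> u = 0)"

text \<open>The trace of a linear endomorphism of \<open>V\<close>; it does not depend on the chosen basis.\<close>

definition trace_on :: "'a::real_vector set \<Rightarrow> ('a \<Rightarrow> 'a) \<Rightarrow> real" where
  "trace_on V f =
     (let B = (SOME B. independent B \<and> span B = V) in \<Sum>b\<in>B. representation B (f b) b)"

definition levi_civita ::
  "'a::real_vector set \<Rightarrow> ('a \<Rightarrow> 'a \<Rightarrow> 'a) \<Rightarrow> ('a \<Rightarrow> 'a \<Rightarrow> real) \<Rightarrow> 'a \<Rightarrow> 'a \<Rightarrow> 'a" where
  "levi_civita V br g u v =
     (THE x. x \<in> V \<and> (\<forall>w\<in>V. 2 * g x w = g (br u v) w + g (br w u) v + g (br w v) u))"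

text \<open>The curvature has the sign \<open>K(u,v) = L\<^bsub>[u,v]\<^esub> - [L\<^sub>u, L\<^sub>v]\<close>.\<close>

definition curvature ::
  "'a::real_vector set \<Rightarrow> ('a \<Rightarrow> 'a \<Rightarrow> 'a) \<Rightarrow> ('a \<Rightarrow> 'a \<Rightarrow> real) \<Rightarrow> 'a \<Rightarrow> 'a \<Rightarrow> 'a \<Rightarrow> 'a" where
  "curvature V br g u v w =
     (let L = levi_civita V br g in L (br u v) w - (L u (L v w) - L v (L u w)))"

definition ric ::
  "'a::real_vector set \<Rightarrow> ('a \<Rightarrow> 'a \<Rightarrow> 'a) \<Rightarrow> ('a \<Rightarrow> 'a \<Rightarrow> real) \<Rightarrow> 'a \<Rightarrow> 'a \<Rightarrow> real" where
  "ric V br g u v = trace_on V (\<lambda>w. curvature V br g u w v)"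

definition Ric_op ::
  "'a::real_vector set \<Rightarrow> ('a \<Rightarrow> 'a \<Rightarrow> 'a) \<Rightarrow> ('a \<Rightarrow> 'a \<Rightarrow> real) \<Rightarrow> 'a \<Rightarrow> 'a" where
  "Ric_op V br g u = (THE x. x \<in> V \<and> (\<forall>v\<in>V. g x v = ric V br g u v))"

definition scalar_curvature ::
  "'a::real_vector set \<Rightarrow> ('a \<Rightarrow> 'a \<Rightarrow> 'a) \<Rightarrow> ('a \<Rightarrow> 'a \<Rightarrow> real) \<Rightarrow> real" where
  "scalar_curvature V br g = trace_on V (Ric_op V br g)"

text \<open>
  The multiset of signs \<open>1\<close>, \<open>-1\<close>, \<open>0\<close> of the diagonal entries of \<open>\<beta>\<close> in a basis of \<open>V\<close> that
  diagonalizes \<open>\<beta>\<close>. By Sylvester's law of inertia it is the same for all such bases.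
\<close>

definition signature_on :: "'a::real_vector set \<Rightarrow> ('a \<Rightarrow> 'a \<Rightarrow> real) \<Rightarrow> real multiset" where
  "signature_on V \<beta> =
     (THE S. \<exists>B. independent B \<and> span B = V \<and>
        (\<forall>u\<in>B. \<forall>v\<in>B. u \<noteq> v \<longrightarrow> \<beta> u v = 0) \<and>
        S = image_mset (\<lambda>v. sgn (\<beta> v v)) (mset_set B))"

end

theory Submission
  imports Defs
begin

text \<open>
  In an orthogonal frame with brackets \<open>[e\<^sub>1, e\<^sub>2] = 2 e\<^sub>3\<close> (and cyclically) and metric
  \<open>diag(a, b, c)\<close>, the Levi-Civita product maps a pair of frame vectors to a multiple of the third
  one, and the Ricci tensor is diagonal with entries \<open>2 (a\<^sup>2 - (b - c)\<^sup>2) / (b c)\<close> and its cyclic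
  analogues. Only the factor \<open>\<mu>\<^sub>2 + \<mu>\<^sub>3 - \<mu>\<^sub>1\<close> of these entries can change sign, and the scalar
  curvature is a positive multiple of
  \<open>(\<mu>\<^sub>1 + \<mu>\<^sub>2 + \<mu>\<^sub>3)\<^sup>2 - 4 \<mu>\<^sub>1 \<mu>\<^sub>2\<close>. As traces and signatures are defined through an unspecified basis,
  basis independence of the trace and Sylvester's law of inertia are needed.
\<close>

section \<open>Basis independence of the trace\<close>

lemma representation_sum_scaleR:
  assumes "independent B" "\<And>i. i \<in> I \<Longrightarrow> f i \<in> span B"
  shows "representation B (\<Sum>i\<in>I. c i *\<^sub>R f i) b = (\<Sum>i\<in>I. c i * representation B (f i) b)"
proof -
  have "representation B (\<Sum>i\<in>I. c i *\<^sub>R f i) = (\<lambda>b. \<Sum>i\<in>I. representation B (c i *\<^sub>R f i) b)"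
    by (rule representation_sum) (use assms in \<open>auto intro: span_scale\<close>)
  then show ?thesis
    using assms by (auto simp: representation_scale intro!: sum.cong)
qed

text \<open>Linearity is assumed on \<open>V\<close> only, because maps built from definite
  descriptions, such as \<open>Ric_op\<close>, are not controlled off \<open>V\<close>; the
  induction therefore keeps every partial sum inside \<open>V\<close>.\<close>

lemma linear_on_sum_scaleR:
  fixes f :: "'a::real_vector \<Rightarrow> 'b::real_vector"
  assumes V: "subspace V"
    and add: "\<And>x y. x \<in> V \<Longrightarrow> y \<in> V \<Longrightarrow> f (x + y) = f x + f y"
    and scale: "\<And>c x. x \<in> V \<Longrightarrow> f (c *\<^sub>R x) = c *\<^sub>R f x"
    and S: "finite S" "S \<subseteq> V"
  shows "f (\<Sum>b\<in>S. u b *\<^sub>R b) = (\<Sum>b\<in>S. u b *\<^sub>R f b)"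
  using S
proof (induction S rule: finite_induct)
  case empty
  show ?case using scale[of 0 0] subspace_0[OF V] by simp
next
  case (insert b S)
  have "(\<Sum>b\<in>S. u b *\<^sub>R b) \<in> V"
    by (rule subspace_sum[OF V]) (use insert in \<open>auto intro: subspace_scale[OF V]\<close>)
  then show ?case
    using insert by (simp add: add scale subspace_scale[OF V])
qed

text \<open>This is tr(PQ) = tr(QP). Expanding each \<open>b\<close> in the basis \<open>C\<close>
  chosen by \<open>trace_on\<close> gives a double sum over \<open>B\<close> and \<open>C\<close>;
  after swapping the sums, the \<open>B\<close>-expansion of \<open>f c\<close> collapses and leaves
  the sum over \<open>C\<close>.\<close>

lemma trace_on_eq:
  assumes B: "finite B" "independent B" "span B = V"
    and add: "\<And>x y. x \<in> V \<Longrightarrow> y \<in> V \<Longrightarrow> f (x + y) = f x + f y"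
    and scale: "\<And>c x. x \<in> V \<Longrightarrow> f (c *\<^sub>R x) = c *\<^sub>R f x"
    and img: "\<And>x. x \<in> V \<Longrightarrow> f x \<in> V"
  shows "trace_on V f = (\<Sum>b\<in>B. representation B (f b) b)"
proof -
  define C where "C = (SOME C. independent C \<and> span C = V)"
  have C: "independent C" "span C = V"
    using someI[of "\<lambda>C. independent C \<and> span C = V" B] B unfolding C_def by auto
  have finC: "finite C"
    using independent_span_bound[OF B(1) C(1)] span_superset[of C] B C by auto
  have V: "subspace V" using B by auto
  have BV: "B \<subseteq> V" and CV: "C \<subseteq> V"
    using span_superset[of B] span_superset[of C] B C by simp_all
  have "(\<Sum>b\<in>B. representation B (f b) b)
      = (\<Sum>b\<in>B. \<Sum>c\<in>C. representation C b c * representation B (f c) b)"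
  proof (rule sum.cong[OF refl])
    fix b assume b: "b \<in> B"
    have "b = (\<Sum>c\<in>C. representation C b c *\<^sub>R c)"
      using sum_representation_eq[OF C(1), of b C] b BV C finC by auto
    then have "f b = f (\<Sum>c\<in>C. representation C b c *\<^sub>R c)" by simp
    also have "\<dots> = (\<Sum>c\<in>C. representation C b c *\<^sub>R f c)"
      by (rule linear_on_sum_scaleR[OF V add scale finC CV])
    moreover have "f c \<in> span B" if "c \<in> C" for c
      using that CV img B by auto
    ultimately show "representation B (f b) b
        = (\<Sum>c\<in>C. representation C b c * representation B (f c) b)"
      using B by (simp add: representation_sum_scaleR)
  qed
  also have "\<dots> = (\<Sum>c\<in>C. \<Sum>b\<in>B. representation B (f c) b * representation C b c)"
    by (subst sum.swap) (simp add: mult.commute)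
  also have "\<dots> = (\<Sum>c\<in>C. representation C (f c) c)"
  proof (rule sum.cong[OF refl])
    fix c assume c: "c \<in> C"
    have "(\<Sum>b\<in>B. representation B (f c) b * representation C b c)
        = representation C (\<Sum>b\<in>B. representation B (f c) b *\<^sub>R b) c"
      by (rule representation_sum_scaleR[symmetric]) (use BV C in auto)
    also have "(\<Sum>b\<in>B. representation B (f c) b *\<^sub>R b) = f c"
      using sum_representation_eq[OF B(2), of "f c" B] c CV B img by auto
    finally show "(\<Sum>b\<in>B. representation B (f c) b * representation C b c)
        = representation C (f c) c" .
  qed
  finally show ?thesis
    by (simp add: trace_on_def C_def Let_def)
qed

section \<open>Sylvester's law of inertia\<close>

text \<open>The conditions of \<open>metric_on\<close> without nondegeneracy: the Ricci tensor
  degenerates when \<open>\<mu>\<^sub>1 = \<mu>\<^sub>2 + \<mu>\<^sub>3\<close>.\<close>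

definition symmetric_bilinear_on :: "'a::real_vector set \<Rightarrow> ('a \<Rightarrow> 'a \<Rightarrow> real) \<Rightarrow> bool" where
  "symmetric_bilinear_on V \<beta> \<longleftrightarrow>
     (\<forall>u\<in>V. \<forall>v\<in>V. \<beta> u v = \<beta> v u) \<and>
     (\<forall>u\<in>V. \<forall>v\<in>V. \<forall>w\<in>V. \<beta> (u + v) w = \<beta> u w + \<beta> v w) \<and>
     (\<forall>c. \<forall>u\<in>V. \<forall>v\<in>V. \<beta> (c *\<^sub>R u) v = c * \<beta> u v)"

text \<open>The bases over which \<open>signature_on\<close> quantifies.\<close>

definition orthogonal_basis_on ::
  "'a::real_vector set \<Rightarrow> ('a \<Rightarrow> 'a \<Rightarrow> real) \<Rightarrow> 'a set \<Rightarrow> bool" where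
  "orthogonal_basis_on V \<beta> B \<longleftrightarrow>
     independent B \<and> span B = V \<and> (\<forall>u\<in>B. \<forall>v\<in>B. u \<noteq> v \<longrightarrow> \<beta> u v = 0)"

text \<open>Expanding the first argument leaves the values \<open>\<beta> b ?x\<close>; symmetry
  moves the sum to the left again, and orthogonality keeps only its term at
  \<open>b\<close>.\<close>

lemma symmetric_bilinear_on_orthogonal_sum:
  assumes V: "subspace V" and \<beta>: "symmetric_bilinear_on V \<beta>"
    and S: "finite S" "S \<subseteq> V" and orth: "\<And>u v. u \<in> S \<Longrightarrow> v \<in> S \<Longrightarrow> u \<noteq> v \<Longrightarrow> \<beta> u v = 0"
  shows "\<beta> (\<Sum>b\<in>S. c b *\<^sub>R b) (\<Sum>b\<in>S. c b *\<^sub>R b) = (\<Sum>b\<in>S. (c b)\<^sup>2 * \<beta> b b)"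
proof -
  let ?x = "\<Sum>b\<in>S. c b *\<^sub>R b"
  have x: "?x \<in> V"
    by (rule subspace_sum[OF V]) (use S in \<open>auto intro: subspace_scale[OF V]\<close>)
  have lin: "\<beta> ?x w = (\<Sum>b\<in>S. c b * \<beta> b w)" if "w \<in> V" for w
    using linear_on_sum_scaleR[OF V _ _ S, of "\<lambda>v. \<beta> v w" c] \<beta> that
    by (simp add: symmetric_bilinear_on_def)
  have "\<beta> b ?x = c b * \<beta> b b" if b: "b \<in> S" for b
  proof -
    have bV: "b \<in> V" using b S by auto
    have "\<beta> b ?x = \<beta> ?x b" using \<beta> bV x by (simp add: symmetric_bilinear_on_def)
    also have "\<dots> = (\<Sum>a\<in>S. c a * \<beta> a b)" by (rule lin[OF bV])
    also have "\<dots> = (\<Sum>a\<in>S. if a = b then c b * \<beta> b b else 0)"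
      by (rule sum.cong) (use orth b in auto)
    finally show ?thesis using S b by simp
  qed
  then show ?thesis
    by (simp add: lin[OF x] power2_eq_square mult.assoc)
qed

text \<open>
  The positive part of one basis and the nonpositive part of the other are together independent,
  as the form would be both positive and nonpositive on a common vector of their spans.
\<close>

lemma inertia_card_le:
  assumes \<beta>: "symmetric_bilinear_on V \<beta>"
    and B: "orthogonal_basis_on V \<beta> B" and C: "orthogonal_basis_on V \<beta> C" and finC: "finite C"
  shows "card {b\<in>B. \<beta> b b > 0} \<le> card {c\<in>C. \<beta> c c > 0}"
proof -
  let ?P = "{b\<in>B. \<beta> b b > 0}" and ?N = "{c\<in>C. \<beta> c c \<le> 0}"
  have V: "subspace V" using B by (auto simp: orthogonal_basis_on_def)
  have BV: "B \<subseteq> V" and CV: "C \<subseteq> V"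
    using span_superset[of B] span_superset[of C] B C by (simp_all add: orthogonal_basis_on_def)
  have finB: "finite B"
    using independent_span_bound[OF finC, of B] B C BV by (simp add: orthogonal_basis_on_def)
  have disj: "?P \<inter> ?N = {}" by auto
  have "independent (?P \<union> ?N)"
  proof (rule independent_if_scalars_zero)
    show "finite (?P \<union> ?N)" using finB finC by auto
  next
    fix c v
    assume "(\<Sum>x\<in>?P \<union> ?N. c x *\<^sub>R x) = 0" and v: "v \<in> ?P \<union> ?N"
    then have sum0: "(\<Sum>x\<in>?P. c x *\<^sub>R x) + (\<Sum>x\<in>?N. c x *\<^sub>R x) = 0"
      using finB finC disj by (simp add: sum.union_disjoint)
    \<comment> \<open>The vanishing combination makes \<open>p\<close> a combination of positive
      vectors and also of nonpositive ones, so \<open>\<beta> p p\<close> is bounded by zero from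
      both sides.\<close>
    define p where "p = (\<Sum>x\<in>?P. c x *\<^sub>R x)"
    have pN: "p = (\<Sum>x\<in>?N. (- c x) *\<^sub>R x)"
      using sum0 by (simp add: p_def sum_negf eq_neg_iff_add_eq_0)
    have bP: "\<beta> p p = (\<Sum>x\<in>?P. (c x)\<^sup>2 * \<beta> x x)"
      unfolding p_def
      by (rule symmetric_bilinear_on_orthogonal_sum[OF V \<beta>])
        (use finB BV B in \<open>auto simp: orthogonal_basis_on_def\<close>)
    have "\<beta> p p = (\<Sum>x\<in>?N. (- c x)\<^sup>2 * \<beta> x x)"
      unfolding pN
      by (rule symmetric_bilinear_on_orthogonal_sum[OF V \<beta>])
        (use finC CV C in \<open>auto simp: orthogonal_basis_on_def\<close>)
    also have "\<dots> \<le> 0"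
      by (rule sum_nonpos) (auto intro: mult_nonneg_nonpos)
    finally have "(\<Sum>x\<in>?P. (c x)\<^sup>2 * \<beta> x x) \<le> 0" using bP by simp
    moreover have "(\<Sum>x\<in>?P. (c x)\<^sup>2 * \<beta> x x) \<ge> 0"
      by (rule sum_nonneg) auto
    ultimately have "(\<Sum>x\<in>?P. (c x)\<^sup>2 * \<beta> x x) = 0" by simp
    \<comment> \<open>Each summand is nonnegative, so each vanishes, and
      \<open>\<beta> x x > 0\<close> on \<open>?P\<close> forces \<open>c x = 0\<close>. What
      remains is a relation inside the independent set \<open>C\<close>.\<close>
    then have "\<forall>x\<in>?P. (c x)\<^sup>2 * \<beta> x x = 0"
      by (subst (asm) sum_nonneg_eq_0_iff) (use finB in auto)
    then have cP: "\<forall>x\<in>?P. c x = 0" by auto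
    then have "(\<Sum>x\<in>?N. c x *\<^sub>R x) = 0" using sum0 by simp
    moreover have "independent ?N"
      by (rule independent_mono[of C]) (use C in \<open>auto simp: orthogonal_basis_on_def\<close>)
    ultimately have "\<forall>x\<in>?N. c x = 0"
      using finC independentD[of ?N ?N c] by auto
    then show "c v = 0" using cP v by auto
  qed
  \<comment> \<open>The independent union has at most \<open>card C\<close> elements; splitting
    \<open>C\<close> by sign and cancelling \<open>card ?N\<close> leaves the claim.\<close>
  moreover have "?P \<union> ?N \<subseteq> span C"
    using BV CV C unfolding orthogonal_basis_on_def by blast
  ultimately have "card (?P \<union> ?N) \<le> card C"
    using independent_span_bound[OF finC] by blast
  moreover have "card (?P \<union> ?N) = card ?P + card ?N"
    by (rule card_Un_disjoint) (use finB finC disj in auto)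
  moreover have "card C = card {c\<in>C. \<beta> c c > 0} + card ?N"
    by (subst card_Un_disjoint[symmetric]) (use finC in \<open>auto intro!: arg_cong[of _ _ card]\<close>)
  ultimately show ?thesis by linarith
qed

text \<open>Exchanging the two bases turns the inequality into an equality; passing to the form
  \<open>- \<beta>\<close> transfers it from positive to negative vectors.\<close>

lemma inertia_card_eq:
  assumes "symmetric_bilinear_on V \<beta>"
    and "orthogonal_basis_on V \<beta> B" "orthogonal_basis_on V \<beta> C" "finite B" "finite C"
  shows "card {b\<in>B. \<beta> b b > 0} = card {c\<in>C. \<beta> c c > 0}"
    and "card {b\<in>B. \<beta> b b < 0} = card {c\<in>C. \<beta> c c < 0}"
proof -
  show "card {b\<in>B. \<beta> b b > 0} = card {c\<in>C. \<beta> c c > 0}"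
    using assms inertia_card_le[OF assms(1)] by (simp add: antisym)
  let ?\<gamma> = "\<lambda>u v. - \<beta> u v"
  have "symmetric_bilinear_on V ?\<gamma>" "orthogonal_basis_on V ?\<gamma> B" "orthogonal_basis_on V ?\<gamma> C"
    using assms by (auto simp: symmetric_bilinear_on_def orthogonal_basis_on_def)
  then have "card {b\<in>B. ?\<gamma> b b > 0} = card {c\<in>C. ?\<gamma> c c > 0}"
    using assms inertia_card_le[of V ?\<gamma>] by (metis (no_types, lifting) antisym)
  then show "card {b\<in>B. \<beta> b b < 0} = card {c\<in>C. \<beta> c c < 0}" by simp
qed

lemma count_sgn_mset_set:
  assumes "finite B"
  shows "count (image_mset (\<lambda>v. sgn (\<beta> v v)) (mset_set B)) s = card {b\<in>B. sgn (\<beta> b b) = (s::real)}"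
  using assms
  by (simp add: count_image_mset vimage_def Int_def conj_commute)

text \<open>The multiplicities of \<open>1\<close> and \<open>-1\<close> agree by
  \<open>inertia_card_eq\<close>. Since the bases have equal size, the multiplicity of
  \<open>0\<close> agrees as well, and no other value of \<open>sgn\<close> occurs.\<close>

lemma sylvester_inertia:
  assumes \<beta>: "symmetric_bilinear_on V \<beta>"
    and B: "orthogonal_basis_on V \<beta> B" and C: "orthogonal_basis_on V \<beta> C"
    and fin: "finite B" "finite C"
  shows "image_mset (\<lambda>v. sgn (\<beta> v v)) (mset_set B) = image_mset (\<lambda>v. sgn (\<beta> v v)) (mset_set C)"
proof (rule multiset_eqI)
  note eqs = inertia_card_eq[OF \<beta> B C fin]
  have card: "card B = card C"
  proof (rule antisym)
    show "card B \<le> card C" "card C \<le> card B"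
      using independent_span_bound[of C B] independent_span_bound[of B C] B C fin
        span_superset[of B] span_superset[of C]
      by (auto simp: orthogonal_basis_on_def)
  qed
  have split: "card A = card {b\<in>A. \<beta> b b > 0} + card {b\<in>A. \<beta> b b < 0} + card {b\<in>A. \<beta> b b = 0}"
    if "finite A" for A
  proof -
    have "A = ({b\<in>A. \<beta> b b > 0} \<union> {b\<in>A. \<beta> b b < 0}) \<union> {b\<in>A. \<beta> b b = 0}" by auto
    then have "card A = card \<dots>" by simp
    also have "\<dots> = card ({b\<in>A. \<beta> b b > 0} \<union> {b\<in>A. \<beta> b b < 0}) + card {b\<in>A. \<beta> b b = 0}"
      by (rule card_Un_disjoint) (use that in auto)
    also have "card ({b\<in>A. \<beta> b b > 0} \<union> {b\<in>A. \<beta> b b < 0})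
        = card {b\<in>A. \<beta> b b > 0} + card {b\<in>A. \<beta> b b < 0}"
      by (rule card_Un_disjoint) (use that in auto)
    finally show ?thesis .
  qed
  have zero: "card {b\<in>B. \<beta> b b = 0} = card {c\<in>C. \<beta> c c = 0}"
    using split[OF fin(1)] split[OF fin(2)] card eqs by linarith
  fix s :: real
  have "card {b\<in>B. sgn (\<beta> b b) = s} = card {c\<in>C. sgn (\<beta> c c) = s}"
  proof (cases "s \<in> {1, -1, 0}")
    case True
    have "sgn x = 1 \<longleftrightarrow> x > 0" "sgn x = -1 \<longleftrightarrow> x < 0" for x :: real
      by (auto simp: sgn_if)
    then show ?thesis using True eqs zero by (auto simp: sgn_zero_iff)
  next
    case False
    then have "{b\<in>A. sgn (\<beta> b b) = s} = {}" for A by (auto simp: sgn_if split: if_splits)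
    then show ?thesis by (simp only:)
  qed
  then show "count (image_mset (\<lambda>v. sgn (\<beta> v v)) (mset_set B)) s
      = count (image_mset (\<lambda>v. sgn (\<beta> v v)) (mset_set C)) s"
    using fin by (simp add: count_sgn_mset_set)
qed

text \<open>Sylvester's law gives the uniqueness that the definite description requires. A competing
  basis is finite, being independent in the span of the finite set \<open>B\<close>.\<close>

lemma signature_on_eq:
  assumes \<beta>: "symmetric_bilinear_on V \<beta>" and B: "orthogonal_basis_on V \<beta> B" and fin: "finite B"
  shows "signature_on V \<beta> = image_mset (\<lambda>v. sgn (\<beta> v v)) (mset_set B)"
  unfolding signature_on_def
proof (rule the_equality)
  show "\<exists>C. independent C \<and> span C = V \<and> (\<forall>u\<in>C. \<forall>v\<in>C. u \<noteq> v \<longrightarrow> \<beta> u v = 0) \<and>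
      image_mset (\<lambda>v. sgn (\<beta> v v)) (mset_set B) = image_mset (\<lambda>v. sgn (\<beta> v v)) (mset_set C)"
    using B by (auto simp: orthogonal_basis_on_def)
next
  fix S
  assume "\<exists>C. independent C \<and> span C = V \<and> (\<forall>u\<in>C. \<forall>v\<in>C. u \<noteq> v \<longrightarrow> \<beta> u v = 0) \<and>
      S = image_mset (\<lambda>v. sgn (\<beta> v v)) (mset_set C)"
  then obtain C where C: "orthogonal_basis_on V \<beta> C"
    and S: "S = image_mset (\<lambda>v. sgn (\<beta> v v)) (mset_set C)"
    by (auto simp: orthogonal_basis_on_def)
  have "finite C"
    using independent_span_bound[OF fin, of C] B C span_superset[of C]
    by (auto simp: orthogonal_basis_on_def)
  then show "S = image_mset (\<lambda>v. sgn (\<beta> v v)) (mset_set B)"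
    using sylvester_inertia[OF \<beta> C B] fin S by simp
qed

section \<open>Nondegeneracy and vectors determined by their pairings\<close>

lemma metric_onD:
  assumes "metric_on V g"
  shows "u \<in> V \<Longrightarrow> v \<in> V \<Longrightarrow> g u v = g v u"
    and "u \<in> V \<Longrightarrow> v \<in> V \<Longrightarrow> w \<in> V \<Longrightarrow> g (u + v) w = g u w + g v w"
    and "u \<in> V \<Longrightarrow> v \<in> V \<Longrightarrow> g (r *\<^sub>R u) v = r * g u v"
    and "u \<in> V \<Longrightarrow> (\<And>v. v \<in> V \<Longrightarrow> g u v = 0) \<Longrightarrow> u = 0"
  using assms unfolding metric_on_def by auto

text \<open>Nondegeneracy applied to \<open>x - y\<close>. This is the uniqueness behind the
  definite descriptions in \<open>levi_civita\<close> and \<open>Ric_op\<close>.\<close>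

lemma metric_on_cancel:
  assumes g: "metric_on V g" and V: "subspace V" and x: "x \<in> V" and y: "y \<in> V"
    and eq: "\<And>w. w \<in> V \<Longrightarrow> g x w = g y w"
  shows "x = y"
proof -
  have "x - y = 0"
  proof (rule metric_onD(4)[OF g])
    fix w assume w: "w \<in> V"
    have "g x w = g ((x - y) + y) w" by simp
    also have "\<dots> = g (x - y) w + g y w"
      by (rule metric_onD(2)[OF g subspace_diff[OF V x y] y w])
    finally show "g (x - y) w = 0" using eq[OF w] by simp
  qed (rule subspace_diff[OF V x y])
  then show ?thesis by simp
qed

lemma levi_civita_eq:
  assumes "metric_on V g" "subspace V" "x \<in> V"
    and "\<And>w. w \<in> V \<Longrightarrow> 2 * g x w = g (br u v) w + g (br w u) v + g (br w v) u"
  shows "levi_civita V br g u v = x"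
  unfolding levi_civita_def
proof (rule the_equality)
  fix y
  assume y: "y \<in> V \<and> (\<forall>w\<in>V. 2 * g y w = g (br u v) w + g (br w u) v + g (br w v) u)"
  have "g y w = g x w" if "w \<in> V" for w
    using assms(4)[OF that] y that by auto
  then show "y = x" using metric_on_cancel[OF assms(1,2)] y assms(3) by blast
qed (use assms in auto)

lemma Ric_op_eq:
  assumes "metric_on V g" "subspace V" "x \<in> V" "\<And>v. v \<in> V \<Longrightarrow> g x v = ric V br g u v"
  shows "Ric_op V br g u = x"
  unfolding Ric_op_def
proof (rule the_equality)
  fix y
  assume "y \<in> V \<and> (\<forall>v\<in>V. g y v = ric V br g u v)"
  then show "y = x" using metric_on_cancel[OF assms(1,2)] assms(3,4) by auto
qed (use assms in auto)

section \<open>Bracket and Levi-Civita product in an orthogonal frame\<close>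

text \<open>The entries \<open>a\<close>, \<open>b\<close>, \<open>c\<close> may have any signs,
  which keeps the formulas cyclically symmetric; the indefinite metric is the instance
  \<open>c = - \<mu>\<^sub>3\<close>.\<close>

locale su2_frame =
  fixes V :: "'a::real_vector set" and br :: "'a \<Rightarrow> 'a \<Rightarrow> 'a" and g :: "'a \<Rightarrow> 'a \<Rightarrow> real"
    and e1 e2 e3 :: 'a and a b c :: real
  assumes distinct: "e1 \<noteq> e2" "e1 \<noteq> e3" "e2 \<noteq> e3"
    and indep: "independent {e1, e2, e3}" and span_eq: "span {e1, e2, e3} = V"
    and bilinear_br: "bilinear br" and alternating: "br x x = 0"
    and br_e: "br e1 e2 = 2 *\<^sub>R e3" "br e2 e3 = 2 *\<^sub>R e1" "br e3 e1 = 2 *\<^sub>R e2"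
    and metric: "metric_on V g"
    and g_diag: "g e1 e1 = a" "g e2 e2 = b" "g e3 e3 = c"
    and g_off: "g e1 e2 = 0" "g e1 e3 = 0" "g e2 e3 = 0"
    and nonzero: "a \<noteq> 0" "b \<noteq> 0" "c \<noteq> 0"
begin

text \<open>Frame coordinates, which reduce identities between vectors of \<open>V\<close> to
  identities between reals.\<close>

definition vec :: "real \<Rightarrow> real \<Rightarrow> real \<Rightarrow> 'a" where
  "vec x y z = x *\<^sub>R e1 + y *\<^sub>R e2 + z *\<^sub>R e3"

lemma vec_unit: "vec 1 0 0 = e1" "vec 0 1 0 = e2" "vec 0 0 1 = e3"
  by (simp_all add: vec_def)

lemma subspace_V: "subspace V"
  using span_eq by auto

lemma vec_in_V [simp]: "vec x y z \<in> V"
  unfolding vec_def span_eq[symmetric]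
  by (intro span_add span_scale span_base) auto

lemma e_in_V: "e1 \<in> V" "e2 \<in> V" "e3 \<in> V"
  by (auto simp: span_eq[symmetric] intro: span_base)

lemma V_cases:
  assumes "u \<in> V" obtains x y z where "u = vec x y z"
proof -
  have "u \<in> span {e1, e2, e3}" using assms span_eq by simp
  then obtain x y z where "u - x *\<^sub>R e1 - y *\<^sub>R e2 - z *\<^sub>R e3 = 0"
    by (auto simp: span_insert)
  then have "u = vec x y z" by (simp add: vec_def algebra_simps)
  then show ?thesis by (rule that)
qed

lemma vec_add: "vec x y z + vec x' y' z' = vec (x + x') (y + y') (z + z')"
  by (simp add: vec_def algebra_simps)

lemma vec_diff: "vec x y z - vec x' y' z' = vec (x - x') (y - y') (z - z')"
  by (simp add: vec_def algebra_simps)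

lemma vec_scale: "r *\<^sub>R vec x y z = vec (r * x) (r * y) (r * z)"
  by (simp add: vec_def algebra_simps)

lemmas vec_simps = vec_add vec_diff vec_scale

lemma representation_vec:
  "representation {e1, e2, e3} (vec x y z) e1 = x"
  "representation {e1, e2, e3} (vec x y z) e2 = y"
  "representation {e1, e2, e3} (vec x y z) e3 = z"
proof -
  have "e1 \<in> span {e1, e2, e3}" "e2 \<in> span {e1, e2, e3}" "e3 \<in> span {e1, e2, e3}"
    by (auto intro: span_base)
  then have "representation {e1, e2, e3} (vec x y z) = (\<lambda>v. x * representation {e1, e2, e3} e1 v
      + y * representation {e1, e2, e3} e2 v + z * representation {e1, e2, e3} e3 v)"
    by (simp add: vec_def representation_add representation_scale indep span_add span_scale)
  then show
    "representation {e1, e2, e3} (vec x y z) e1 = x"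
    "representation {e1, e2, e3} (vec x y z) e2 = y"
    "representation {e1, e2, e3} (vec x y z) e3 = z"
    using distinct by (auto simp: representation_basis indep)
qed

text \<open>Twice the cross product of the coordinate vectors.\<close>

lemma br_vec:
  "br (vec x y z) (vec x' y' z')
    = vec (2 * (y * z' - z * y')) (2 * (z * x' - x * z')) (2 * (x * y' - y * x'))"
proof -
  have anti: "br v u = - br u v" for u v
  proof -
    \<comment> \<open>Polarization of \<open>br x x = 0\<close> yields antisymmetry.\<close>
    have "br u v + br v u = br (u + v) (u + v)"
      by (simp add: bilinear_ladd[OF bilinear_br] bilinear_radd[OF bilinear_br]
          alternating[of u] alternating[of v])
    then show ?thesis by (simp add: alternating eq_neg_iff_add_eq_0 add.commute)
  qed
  have br_units: "br e1 e1 = vec 0 0 0" "br e2 e2 = vec 0 0 0" "br e3 e3 = vec 0 0 0"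
    "br e1 e2 = vec 0 0 2" "br e2 e3 = vec 2 0 0" "br e3 e1 = vec 0 2 0"
    "br e2 e1 = vec 0 0 (-2)" "br e3 e2 = vec (-2) 0 0" "br e1 e3 = vec 0 (-2) 0"
    using anti[of e2 e1] anti[of e3 e2] anti[of e1 e3] br_e
    by (simp_all add: alternating vec_def)
  have left: "br (vec x y z) v = x *\<^sub>R br e1 v + y *\<^sub>R br e2 v + z *\<^sub>R br e3 v" for v
    by (simp add: vec_def bilinear_ladd[OF bilinear_br] bilinear_lmul[OF bilinear_br])
  have right: "br v (vec x' y' z') = x' *\<^sub>R br v e1 + y' *\<^sub>R br v e2 + z' *\<^sub>R br v e3" for v
    by (simp add: vec_def bilinear_radd[OF bilinear_br] bilinear_rmul[OF bilinear_br])
  show ?thesis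
    unfolding left unfolding right unfolding br_units vec_simps
    by (rule arg_cong3[of _ _ _ _ _ _ vec]) (simp_all add: algebra_simps)
qed

lemma g_vec: "g (vec x y z) (vec x' y' z') = a * x * x' + b * y * y' + c * z * z'"
proof -
  note e = e_in_V and sym = metric_onD(1)[OF metric]
  have lin: "g (vec x y z) w = x * g e1 w + y * g e2 w + z * g e3 w" if "w \<in> V" for x y z w
    unfolding vec_def using that e
    by (simp add: metric_onD(2,3)[OF metric] subspace_add[OF subspace_V]
        subspace_scale[OF subspace_V])
  have "g e2 e1 = 0" "g e3 e1 = 0" "g e3 e2 = 0"
    using sym e g_off by metis+
  then have "g (vec x' y' z') e1 = a * x'" "g (vec x' y' z') e2 = b * y'"
    "g (vec x' y' z') e3 = c * z'"
    using e by (simp_all add: lin g_diag g_off)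
  then have "g e1 (vec x' y' z') = a * x'" "g e2 (vec x' y' z') = b * y'"
    "g e3 (vec x' y' z') = c * z'"
    using sym e vec_in_V by metis+
  then show ?thesis
    by (simp add: lin)
qed

text \<open>On the frame, the Koszul formula sends \<open>(e1, e2)\<close> to
  \<open>((b + c - a) / c) *\<^sub>R e3\<close> and \<open>(e2, e1)\<close> to
  \<open>- ((a + c - b) / c) *\<^sub>R e3\<close>, similarly for the cyclic shifts, and
  \<open>(e1, e1)\<close>, \<open>(e2, e2)\<close>, \<open>(e3, e3)\<close> to zero. The coordinates
  are the bilinear extension, checked by pairing with an arbitrary \<open>w\<close>.\<close>

lemma levi_civita_vec:
  "levi_civita V br g (vec x y z) (vec x' y' z') =
    vec (((a + c - b) * y * z' - (a + b - c) * z * y') / a)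
      (((a + b - c) * z * x' - (b + c - a) * x * z') / b)
      (((b + c - a) * x * y' - (a + c - b) * y * x') / c)"
proof (rule levi_civita_eq[OF metric subspace_V vec_in_V])
  fix w assume "w \<in> V"
  then obtain p q r where "w = vec p q r" by (rule V_cases)
  then show "2 * g (vec (((a + c - b) * y * z' - (a + b - c) * z * y') / a)
      (((a + b - c) * z * x' - (b + c - a) * x * z') / b)
      (((b + c - a) * x * y' - (a + c - b) * y * x') / c)) w =
      g (br (vec x y z) (vec x' y' z')) w + g (br w (vec x y z)) (vec x' y' z')
      + g (br w (vec x' y' z')) (vec x y z)"
    using nonzero by (simp add: br_vec g_vec) (simp add: algebra_simps)
qed

lemma br_in_V: "u \<in> V \<Longrightarrow> v \<in> V \<Longrightarrow> br u v \<in> V"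
  by (auto elim!: V_cases simp: br_vec)

text \<open>Linearity is read off the coordinate formula; it lets the curvature endomorphism meet
  the hypotheses of \<open>trace_on_vec\<close>.\<close>

lemma levi_civita_linear:
  assumes "u \<in> V" "v \<in> V" "w \<in> V"
  shows "levi_civita V br g u v \<in> V"
    and "levi_civita V br g (u + v) w = levi_civita V br g u w + levi_civita V br g v w"
    and "levi_civita V br g w (u + v) = levi_civita V br g w u + levi_civita V br g w v"
    and "levi_civita V br g (r *\<^sub>R u) w = r *\<^sub>R levi_civita V br g u w"
    and "levi_civita V br g w (r *\<^sub>R u) = r *\<^sub>R levi_civita V br g w u"
proof -
  obtain x y z x' y' z' p q s where uvw: "u = vec x y z" "v = vec x' y' z'" "w = vec p q s"
    using assms by (metis V_cases)
  show "levi_civita V br g u v \<in> V"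
    by (simp add: uvw levi_civita_vec)
  show "levi_civita V br g (u + v) w = levi_civita V br g u w + levi_civita V br g v w"
    "levi_civita V br g w (u + v) = levi_civita V br g w u + levi_civita V br g w v"
    "levi_civita V br g (r *\<^sub>R u) w = r *\<^sub>R levi_civita V br g u w"
    "levi_civita V br g w (r *\<^sub>R u) = r *\<^sub>R levi_civita V br g w u"
    unfolding uvw vec_simps levi_civita_vec
    by (rule arg_cong3[of _ _ _ _ _ _ vec]; simp add: add_divide_distrib[symmetric];
        simp add: algebra_simps)+
qed

text \<open>The diagonal of the matrix of \<open>f\<close> in the frame. The frame vectors are
  written as \<open>vec\<close> terms so that coordinate formulas apply to their images
  directly.\<close>

lemma trace_on_vec:
  assumes add: "\<And>x y. x \<in> V \<Longrightarrow> y \<in> V \<Longrightarrow> f (x + y) = f x + f y"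
    and scale: "\<And>c x. x \<in> V \<Longrightarrow> f (c *\<^sub>R x) = c *\<^sub>R f x"
    and "f (vec 1 0 0) = vec x1 y1 z1" "f (vec 0 1 0) = vec x2 y2 z2" "f (vec 0 0 1) = vec x3 y3 z3"
  shows "trace_on V f = x1 + y2 + z3"
proof -
  note f_e = assms(3-5)[unfolded vec_unit]
  \<comment> \<open>Invariance of \<open>V\<close> follows from linearity and the three given
    images.\<close>
  have "f v \<in> V" if v: "v \<in> V" for v
  proof -
    obtain x y z where "v = vec x y z" using v by (rule V_cases)
    then have "f v = x *\<^sub>R f e1 + y *\<^sub>R f e2 + z *\<^sub>R f e3"
      by (simp add: vec_def add scale e_in_V subspace_add[OF subspace_V] subspace_scale[OF subspace_V])
    then show ?thesis
      by (simp add: f_e vec_simps)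
  qed
  then have "trace_on V f
      = (\<Sum>b\<in>{e1, e2, e3}. representation {e1, e2, e3} (f b) b)"
    by (intro trace_on_eq indep span_eq add scale) auto
  then show ?thesis
    using distinct by (simp add: f_e representation_vec)
qed

section \<open>Ricci tensor, scalar curvature and signature in the frame\<close>

text \<open>The difference of squares is \<open>(a + b - c) * (a + c - b)\<close>, a product of two
  of the numerators in \<open>levi_civita_vec\<close>, in the manner of Milnor's formulas for
  unimodular three-dimensional Lie groups.\<close>

definition ric1 where "ric1 = 2 * (a\<^sup>2 - (b - c)\<^sup>2) / (b * c)"
definition ric2 where "ric2 = 2 * (b\<^sup>2 - (a - c)\<^sup>2) / (a * c)"
definition ric3 where "ric3 = 2 * (c\<^sup>2 - (a - b)\<^sup>2) / (a * b)"

text \<open>Only the diagonal coordinates of the three images under \<open>?K\<close> enter the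
  trace, so the images stay existentially quantified and just their diagonal sum is
  simplified.\<close>

lemma ric_vec:
  "ric V br g (vec x y z) (vec x' y' z') = ric1 * x * x' + ric2 * y * y' + ric3 * z * z'"
proof -
  let ?K = "\<lambda>w. curvature V br g (vec x y z) w (vec x' y' z')"
  note K = curvature_def Let_def br_vec levi_civita_vec vec_diff
  have "\<exists>x1 y1 z1 x2 y2 z2 x3 y3 z3.
    ?K (vec 1 0 0) = vec x1 y1 z1 \<and> ?K (vec 0 1 0) = vec x2 y2 z2 \<and> ?K (vec 0 0 1) = vec x3 y3 z3 \<and>
    x1 + y2 + z3 = ric1 * x * x' + ric2 * y * y' + ric3 * z * z'"
    unfolding K
    \<comment> \<open>The witnesses are the coordinates in the unfolded left-hand sides, found by reflexivity.\<close>
    by (intro exI conjI, (rule refl)+, use nonzero in \<open>simp add: ric1_def ric2_def ric3_def field_simps\<close>)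
      (simp add: algebra_simps power2_eq_square)
  then obtain x1 y1 z1 x2 y2 z2 x3 y3 z3 where
    e: "?K (vec 1 0 0) = vec x1 y1 z1" "?K (vec 0 1 0) = vec x2 y2 z2" "?K (vec 0 0 1) = vec x3 y3 z3" and
    sum: "x1 + y2 + z3 = ric1 * x * x' + ric2 * y * y' + ric3 * z * z'"
    by blast
  have "trace_on V ?K = x1 + y2 + z3"
    by (rule trace_on_vec[OF _ _ e])
      (simp_all add: curvature_def Let_def br_in_V bilinear_radd[OF bilinear_br]
        bilinear_rmul[OF bilinear_br] levi_civita_linear scaleR_diff_right)
  then show ?thesis by (simp add: ric_def sum)
qed

text \<open>Both \<open>g\<close> and \<open>ric\<close> are diagonal in the frame, so
  \<open>Ric_op\<close> scales each frame vector by the quotient of the corresponding diagonal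
  entries.\<close>

lemma scalar_curvature_eq: "scalar_curvature V br g = ric1 / a + ric2 / b + ric3 / c"
proof -
  have Ric: "Ric_op V br g (vec x y z) = vec (ric1 * x / a) (ric2 * y / b) (ric3 * z / c)" for x y z
  proof (rule Ric_op_eq[OF metric subspace_V vec_in_V])
    fix v assume "v \<in> V"
    then obtain p q r where "v = vec p q r" by (rule V_cases)
    then show "g (vec (ric1 * x / a) (ric2 * y / b) (ric3 * z / c)) v = ric V br g (vec x y z) v"
      using nonzero by (simp add: ric_vec g_vec)
  qed
  show ?thesis
    unfolding scalar_curvature_def
  proof (rule trace_on_vec)
    fix u v assume "u \<in> V" "v \<in> V"
    then obtain p q r p' q' r' where "u = vec p q r" "v = vec p' q' r'" by (metis V_cases)
    then show "Ric_op V br g (u + v) = Ric_op V br g u + Ric_op V br g v"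
      by (simp add: vec_simps Ric algebra_simps add_divide_distrib)
  next
    fix s u assume "u \<in> V"
    then obtain p q r where "u = vec p q r" by (metis V_cases)
    then show "Ric_op V br g (s *\<^sub>R u) = s *\<^sub>R Ric_op V br g u"
      by (simp add: vec_simps Ric algebra_simps)
  next
    show "Ric_op V br g (vec 1 0 0) = vec (ric1 / a) 0 0"
      "Ric_op V br g (vec 0 1 0) = vec 0 (ric2 / b) 0"
      "Ric_op V br g (vec 0 0 1) = vec 0 0 (ric3 / c)"
      by (simp_all add: Ric)
  qed
qed

lemma ric_e:
  "ric V br g e1 e1 = ric1" "ric V br g e2 e2 = ric2" "ric V br g e3 e3 = ric3"
  "ric V br g e1 e2 = 0" "ric V br g e1 e3 = 0" "ric V br g e2 e3 = 0"
  "ric V br g e2 e1 = 0" "ric V br g e3 e1 = 0" "ric V br g e3 e2 = 0"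
  using ric_vec[of 1 0 0 1 0 0] ric_vec[of 0 1 0 0 1 0] ric_vec[of 0 0 1 0 0 1]
    ric_vec[of 1 0 0 0 1 0] ric_vec[of 1 0 0 0 0 1] ric_vec[of 0 1 0 0 0 1]
    ric_vec[of 0 1 0 1 0 0] ric_vec[of 0 0 1 1 0 0] ric_vec[of 0 0 1 0 1 0]
  unfolding vec_unit by simp_all

lemma signature_ric: "signature_on V (ric V br g) = {#sgn ric1, sgn ric2, sgn ric3#}"
proof -
  have "symmetric_bilinear_on V (ric V br g)"
    unfolding symmetric_bilinear_on_def
    by (auto elim!: V_cases simp: vec_simps ric_vec algebra_simps)
  moreover have "orthogonal_basis_on V (ric V br g) {e1, e2, e3}"
    using indep span_eq by (auto simp: orthogonal_basis_on_def ric_e)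
  ultimately show ?thesis
    using distinct by (simp add: signature_on_eq ric_e)
qed

end

section \<open>The commutator bracket and the indefinite metric on su(2)\<close>

lemma bilinear_commutator: "bilinear (commutator :: 'a::real_algebra_1^'n^'n \<Rightarrow> _)"
proof -
  have "(r *\<^sub>R A) ** B = r *\<^sub>R (A ** B)" "A ** (r *\<^sub>R B) = r *\<^sub>R (A ** B)"
    for r and A B :: "'a^'n^'n"
    by (simp_all add: matrix_matrix_mult_def vec_eq_iff scaleR_sum_right)
  moreover have "(A + B) ** C = A ** C + B ** C" for A B C :: "'a^'n^'n"
    by (simp add: matrix_matrix_mult_def vec_eq_iff distrib_right sum.distrib)
  ultimately show ?thesis
    by (auto simp: bilinear_def commutator_def matrix_add_ldistrib 
        algebra_simps intro!: linearI)
qed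

lemma range_vector_3: "range (($) (vector [x, y, z] :: 'a::zero^3)) = {x, y, z}"
  by (simp add: UNIV_3 insert_commute)

theorem proposition4p2:
  fixes \<sigma>\<^sub>x \<sigma>\<^sub>y \<sigma>\<^sub>z :: "complex^2^2"
    and g :: "complex^2^2 \<Rightarrow> complex^2^2 \<Rightarrow> real"
    and \<mu>\<^sub>1 \<mu>\<^sub>2 \<mu>\<^sub>3 :: real
  assumes basis: "ordered_basis su2 (vector [\<sigma>\<^sub>x, \<sigma>\<^sub>y, \<sigma>\<^sub>z] :: complex^2^2^3)"
    and brackets:
      "commutator \<sigma>\<^sub>x \<sigma>\<^sub>y = 2 *\<^sub>R \<sigma>\<^sub>z"
      "commutator \<sigma>\<^sub>y \<sigma>\<^sub>z = 2 *\<^sub>R \<sigma>\<^sub>x"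
      "commutator \<sigma>\<^sub>z \<sigma>\<^sub>x = 2 *\<^sub>R \<sigma>\<^sub>y"
    and mu: "\<mu>\<^sub>1 \<ge> \<mu>\<^sub>2" "\<mu>\<^sub>2 > 0" "\<mu>\<^sub>3 > 0"
    and metric: "metric_on su2 g"
      "gram_matrix g (vector [\<sigma>\<^sub>x, \<sigma>\<^sub>y, \<sigma>\<^sub>z] :: complex^2^2^3) = diag (vector [\<mu>\<^sub>1, \<mu>\<^sub>2, - \<mu>\<^sub>3])"
  shows
    "gram_matrix (ric su2 commutator g) (vector [\<sigma>\<^sub>x, \<sigma>\<^sub>y, \<sigma>\<^sub>z] :: complex^2^2^3) =
       diag (vector
         [- (2 * (\<mu>\<^sub>1 - \<mu>\<^sub>2 - \<mu>\<^sub>3) * (\<mu>\<^sub>1 + \<mu>\<^sub>2 + \<mu>\<^sub>3) / (\<mu>\<^sub>2 * \<mu>\<^sub>3)),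
          2 * (\<mu>\<^sub>1 + \<mu>\<^sub>2 + \<mu>\<^sub>3) * (\<mu>\<^sub>1 - \<mu>\<^sub>2 + \<mu>\<^sub>3) / (\<mu>\<^sub>1 * \<mu>\<^sub>3),
          - (2 * (\<mu>\<^sub>1 - \<mu>\<^sub>2 - \<mu>\<^sub>3) * (\<mu>\<^sub>1 - \<mu>\<^sub>2 + \<mu>\<^sub>3) / (\<mu>\<^sub>1 * \<mu>\<^sub>2))])
     \<and> scalar_curvature su2 commutator g =
       2 * ((sqrt \<mu>\<^sub>1 + sqrt \<mu>\<^sub>2)\<^sup>2 + \<mu>\<^sub>3) * ((sqrt \<mu>\<^sub>1 - sqrt \<mu>\<^sub>2)\<^sup>2 + \<mu>\<^sub>3) / (\<mu>\<^sub>1 * \<mu>\<^sub>2 * \<mu>\<^sub>3)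
     \<and> scalar_curvature su2 commutator g > 0
     \<and> (\<mu>\<^sub>1 < \<mu>\<^sub>2 + \<mu>\<^sub>3 \<longrightarrow> signature_on su2 (ric su2 commutator g) = {#1, 1, 1#})
     \<and> (\<mu>\<^sub>1 > \<mu>\<^sub>2 + \<mu>\<^sub>3 \<longrightarrow> signature_on su2 (ric su2 commutator g) = {#1, -1, -1#})
     \<and> (\<mu>\<^sub>1 = \<mu>\<^sub>2 + \<mu>\<^sub>3 \<longrightarrow> signature_on su2 (ric su2 commutator g) = {#1, 0, 0#})"
proof -
  let ?b = "vector [\<sigma>\<^sub>x, \<sigma>\<^sub>y, \<sigma>\<^sub>z] :: complex^2^2^3"
  have inj: "inj (($) ?b)" using basis by (simp add: ordered_basis_def)
  have gram: "g (?b $ i) (?b $ j) = (if i = j then vector [\<mu>\<^sub>1, \<mu>\<^sub>2, - \<mu>\<^sub>3] $ i else 0)" for i j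
    using metric(2) by (simp add: gram_matrix_def diag_def vec_eq_iff)
  interpret su2_frame su2 commutator g \<sigma>\<^sub>x \<sigma>\<^sub>y \<sigma>\<^sub>z \<mu>\<^sub>1 \<mu>\<^sub>2 "- \<mu>\<^sub>3"
  proof
    show "\<sigma>\<^sub>x \<noteq> \<sigma>\<^sub>y" "\<sigma>\<^sub>x \<noteq> \<sigma>\<^sub>z" "\<sigma>\<^sub>y \<noteq> \<sigma>\<^sub>z"
      using inj_eq[OF inj, of 1 2] inj_eq[OF inj, of 1 3] inj_eq[OF inj, of 2 3] by auto
    show "independent {\<sigma>\<^sub>x, \<sigma>\<^sub>y, \<sigma>\<^sub>z}" "span {\<sigma>\<^sub>x, \<sigma>\<^sub>y, \<sigma>\<^sub>z} = su2"
      using basis by (simp_all add: ordered_basis_def range_vector_3)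
    show "g \<sigma>\<^sub>x \<sigma>\<^sub>x = \<mu>\<^sub>1" "g \<sigma>\<^sub>y \<sigma>\<^sub>y = \<mu>\<^sub>2" "g \<sigma>\<^sub>z \<sigma>\<^sub>z = - \<mu>\<^sub>3"
      using gram[of 1 1] gram[of 2 2] gram[of 3 3] by simp_all
    show "g \<sigma>\<^sub>x \<sigma>\<^sub>y = 0" "g \<sigma>\<^sub>x \<sigma>\<^sub>z = 0" "g \<sigma>\<^sub>y \<sigma>\<^sub>z = 0"
      using gram[of 1 2] gram[of 1 3] gram[of 2 3] by simp_all
    show "commutator x x = 0" for x :: "complex^2^2" by (simp add: commutator_def)
  qed (use brackets mu metric bilinear_commutator in auto)
  \<comment> \<open>The numerators factor as differences of squares at
    \<open>c = - \<mu>\<^sub>3\<close>, which turns \<open>b - c\<close> into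
    \<open>\<mu>\<^sub>2 + \<mu>\<^sub>3\<close> and \<open>a - c\<close> into
    \<open>\<mu>\<^sub>1 + \<mu>\<^sub>3\<close>.\<close>
  have r1: "ric1 = - (2 * (\<mu>\<^sub>1 - \<mu>\<^sub>2 - \<mu>\<^sub>3) * (\<mu>\<^sub>1 + \<mu>\<^sub>2 + \<mu>\<^sub>3) / (\<mu>\<^sub>2 * \<mu>\<^sub>3))"
    and r2: "ric2 = 2 * (\<mu>\<^sub>1 + \<mu>\<^sub>2 + \<mu>\<^sub>3) * (\<mu>\<^sub>1 - \<mu>\<^sub>2 + \<mu>\<^sub>3) / (\<mu>\<^sub>1 * \<mu>\<^sub>3)"
    and r3: "ric3 = - (2 * (\<mu>\<^sub>1 - \<mu>\<^sub>2 - \<mu>\<^sub>3) * (\<mu>\<^sub>1 - \<mu>\<^sub>2 + \<mu>\<^sub>3) / (\<mu>\<^sub>1 * \<mu>\<^sub>2))"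
    using mu unfolding ric1_def ric2_def ric3_def
    by (simp_all add: field_simps power2_eq_square)
  have gram_ric: "gram_matrix (ric su2 commutator g) ?b = diag (vector [ric1, ric2, ric3])"
    by (simp add: gram_matrix_def diag_def vec_eq_iff forall_3 ric_e)
  have pos: "\<mu>\<^sub>1 > 0" using mu by simp
  define s t where "s = sqrt \<mu>\<^sub>1" and "t = sqrt \<mu>\<^sub>2"
  have st: "\<mu>\<^sub>1 = s\<^sup>2" "\<mu>\<^sub>2 = t\<^sup>2" using pos mu by (simp_all add: s_def t_def)
  have "scalar_curvature su2 commutator g = ric1 / \<mu>\<^sub>1 + ric2 / \<mu>\<^sub>2 - ric3 / \<mu>\<^sub>3"
    by (simp add: scalar_curvature_eq)
  also have "\<dots> = 2 * ((\<mu>\<^sub>1 + \<mu>\<^sub>2 + \<mu>\<^sub>3)\<^sup>2 - 4 * \<mu>\<^sub>1 * \<mu>\<^sub>2) / (\<mu>\<^sub>1 * \<mu>\<^sub>2 * \<mu>\<^sub>3)"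
    using mu pos unfolding r1 r2 r3
    by (simp add: field_simps) (simp add: algebra_simps power2_eq_square)
  \<comment> \<open>A difference of squares again: the subtracted term is
    \<open>(2 * s * t)\<^sup>2\<close>, and adding or subtracting \<open>2 * s * t\<close> completes
    \<open>s\<^sup>2 + t\<^sup>2\<close> to a square.\<close>
  also have "(\<mu>\<^sub>1 + \<mu>\<^sub>2 + \<mu>\<^sub>3)\<^sup>2 - 4 * \<mu>\<^sub>1 * \<mu>\<^sub>2 = ((s + t)\<^sup>2 + \<mu>\<^sub>3) * ((s - t)\<^sup>2 + \<mu>\<^sub>3)"
    unfolding st by (simp add: algebra_simps power2_eq_square)
  finally have scal: "scalar_curvature su2 commutator g =
      2 * ((sqrt \<mu>\<^sub>1 + sqrt \<mu>\<^sub>2)\<^sup>2 + \<mu>\<^sub>3) * ((sqrt \<mu>\<^sub>1 - sqrt \<mu>\<^sub>2)\<^sup>2 + \<mu>\<^sub>3) / (\<mu>\<^sub>1 * \<mu>\<^sub>2 * \<mu>\<^sub>3)"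
    by (simp add: s_def t_def mult.assoc)
  have scal_pos: "scalar_curvature su2 commutator g > 0"
    unfolding scal using mu pos
    by (intro divide_pos_pos mult_pos_pos add_nonneg_pos) auto
  have sgn1: "sgn ric1 = sgn (\<mu>\<^sub>2 + \<mu>\<^sub>3 - \<mu>\<^sub>1)" and sgn3: "sgn ric3 = sgn (\<mu>\<^sub>2 + \<mu>\<^sub>3 - \<mu>\<^sub>1)"
  proof -
    have "ric1 = (\<mu>\<^sub>2 + \<mu>\<^sub>3 - \<mu>\<^sub>1) * (2 * (\<mu>\<^sub>1 + \<mu>\<^sub>2 + \<mu>\<^sub>3) / (\<mu>\<^sub>2 * \<mu>\<^sub>3))"
      "ric3 = (\<mu>\<^sub>2 + \<mu>\<^sub>3 - \<mu>\<^sub>1) * (2 * (\<mu>\<^sub>1 - \<mu>\<^sub>2 + \<mu>\<^sub>3) / (\<mu>\<^sub>1 * \<mu>\<^sub>2))"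
      using mu pos unfolding r1 r3 by (simp_all add: field_simps)
    \<comment> \<open>The ordering \<open>\<mu>\<^sub>1 \<ge> \<mu>\<^sub>2\<close> makes
      \<open>\<mu>\<^sub>1 - \<mu>\<^sub>2 + \<mu>\<^sub>3\<close> positive; the same factor occurs
      in \<open>ric2\<close>.\<close>
    moreover have "2 * (\<mu>\<^sub>1 + \<mu>\<^sub>2 + \<mu>\<^sub>3) / (\<mu>\<^sub>2 * \<mu>\<^sub>3) > 0" "2 * (\<mu>\<^sub>1 - \<mu>\<^sub>2 + \<mu>\<^sub>3) / (\<mu>\<^sub>1 * \<mu>\<^sub>2) > 0"
      using mu pos by (auto intro!: divide_pos_pos mult_pos_pos)
    ultimately show "sgn ric1 = sgn (\<mu>\<^sub>2 + \<mu>\<^sub>3 - \<mu>\<^sub>1)" "sgn ric3 = sgn (\<mu>\<^sub>2 + \<mu>\<^sub>3 - \<mu>\<^sub>1)"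
      by (simp_all only: sgn_mult sgn_pos mult_1_right)
  qed
  have sgn2: "sgn ric2 = 1"
    unfolding r2 using mu pos by (intro sgn_pos divide_pos_pos mult_pos_pos) auto
  \<comment> \<open>The always positive sign, that of \<open>ric2\<close>, is listed first; the
    other two coincide, so one sign decides all three cases.\<close>
  have sig: "signature_on su2 (ric su2 commutator g)
      = {#1, sgn (\<mu>\<^sub>2 + \<mu>\<^sub>3 - \<mu>\<^sub>1), sgn (\<mu>\<^sub>2 + \<mu>\<^sub>3 - \<mu>\<^sub>1)#}"
    by (simp add: signature_ric sgn1 sgn2 sgn3 add_mset_commute)
  show ?thesis
    unfolding sig gram_ric r1 r2 r3
    using scal scal_pos by (simp add: sgn_if)
qed

end
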